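(* Let $\{x,x_1\}$ be a Mannheim $D$-pair in $E^3$, and let $\theta$ be the angle between the tangent vectors $\vec T$ and $\vec T_1$ at corresponding points. Then the following relations hold at corresponding points: (i) $k_{g_1} = -\left(k_n \dfrac{ds}{ds_1} + \dfrac{d\theta}{ds_1}\right)$, (ii) $\tau_g \dfrac{ds}{ds_1} = -k_{n_1} \sin\theta + \tau_{g_1} \cos\theta$, (iii) $k_g \dfrac{ds}{ds_1} = k_{n_1} \cos\theta + \tau_{g_1} \sin\theta$, (iv) $\tau_{g_1} = (k_g \sin\theta + \tau_g \cos\theta) \dfrac{ds}{ds_1}$.
   Context: $E^3$ is Euclidean 3-space. For an arc length parametrized curve $x(s)$ lying on an oriented surface $S$, the Darboux frame $\{\vec T,\vec g,\vec n\}$ consists of the unit tangent $\vec T$ of $x$, the unit normal $\vec n$ of $S$ along $x$, and $\vec g=\vec n\times\vec T$. The geodesic curvature $k_g$, normal curvature $k_n$ and geodesic torsion $\tau_g$ are defined by $$\frac{d\vec T}{ds}=k_g\vec g+k_n\vec n,\quad \frac{d\vec g}{ds}=-k_g\vec T+\tau_g\vec n,\quad \frac{d\vec n}{ds}=-k_n\vec T-\tau_g\vec g.$$ For $x_1(s_1)$ on $S_1$ the corresponding objects are denoted $\{\vec T_1,\vec g_1,\vec n_1\}$, $k_{g_1},k_{n_1},\tau_{g_1}$ (derivatives with respect to $s_1$). Definition (Mannheim partner $D$-curves). Let $x(s)$ and $x_1(s_1)$ be arc length parametrized curves lying fully on oriented surfaces $S$ and $S_1$. If there is a correspondence between the points of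 $x$ and $x_1$ (so that $s$ is a function of $s_1$) such that at corresponding points the Darboux frame element $\vec g$ of $x$ coincides with the Darboux frame element $\vec n_1$ of $x_1$, then $x$ is called a Mannheim $D$-curve, $x_1$ a Mannheim partner $D$-curve of $x$, and $\{x,x_1\}$ a Mannheim $D$-pair. Coincidence is understood along a common line: corresponding points are related by $\vec x(s(s_1))=\vec x_1(s_1)+\lambda\,\vec n_1(s_1)$, where for a Mannheim $D$-pair $\lambda$ is a nonzero constant. The angle $\theta$ (a differentiable function of $s_1$) is oriented so that $\vec T=\cos\theta\,\vec T_1+\sin\theta\,\vec g_1$. *)

theory Defs
  imports "HOL-Analysis.Analysis"
begin

unbundle cross3_syntax

section \<open>Regular oriented surfaces in Euclidean 3-space\<close>

text \<open>Only used on open sets. In finite dimension, continuity of every directional derivative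
  of a differentiable map is the usual continuity of its total derivative.\<close>

primrec Ck_on :: "nat \<Rightarrow> ('a::real_normed_vector \<Rightarrow> 'b::real_normed_vector) \<Rightarrow> 'a set \<Rightarrow> bool" where
  "Ck_on 0 f U \<longleftrightarrow> continuous_on U f"
| "Ck_on (Suc k) f U \<longleftrightarrow>
     (\<forall>p\<in>U. f differentiable (at p)) \<and> (\<forall>v. Ck_on k (\<lambda>p. frechet_derivative f (at p) v) U)"

definition regular_surface :: "(real^3) set \<Rightarrow> bool" where
  "regular_surface S \<longleftrightarrow>
     (\<forall>p\<in>S. \<exists>(U :: (real^2) set) V X Y.
        open U \<and> open V \<and> p \<in> V \<and> Ck_on 2 X U \<and> homeomorphism U (S \<inter> V) X Y \<and>
        (\<forall>q\<in>U. inj (frechet_derivative X (at q))))"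

definition tangent_space :: "(real^3) set \<Rightarrow> real^3 \<Rightarrow> (real^3) set" where
  "tangent_space S p =
     {v. \<exists>\<epsilon>>0. \<exists>\<alpha>. \<alpha> C1_differentiable_on {-\<epsilon><..<\<epsilon>} \<and> \<alpha> ` {-\<epsilon><..<\<epsilon>} \<subseteq> S \<and>
         \<alpha> 0 = p \<and> (\<alpha> has_vector_derivative v) (at 0)}"

text \<open>The orientation is the unit normal field \<open>N\<close>. It is only meaningful on \<open>S\<close>, so its
  differentiability is that of a map on a subset of Euclidean space: existence of local
  \<open>C\<^sup>1\<close> extensions. A \<open>C\<^sup>2\<close> surface has normal fields of class \<open>C\<^sup>1\<close> only.\<close>

definition oriented_surface :: "(real^3) set \<Rightarrow> (real^3 \<Rightarrow> real^3) \<Rightarrow> bool" where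
  "oriented_surface S N \<longleftrightarrow>
     regular_surface S \<and>
     (\<forall>p\<in>S. norm (N p) = 1 \<and> (\<forall>v\<in>tangent_space S p. orthogonal (N p) v)) \<and>
     (\<forall>p\<in>S. \<exists>V G. open V \<and> p \<in> V \<and> Ck_on 1 G V \<and> (\<forall>q\<in>S \<inter> V. G q = N q))"

section \<open>Curves on surfaces and the Darboux frame\<close>

definition unit_speed_curve_on ::
  "real set \<Rightarrow> (real \<Rightarrow> real^3) \<Rightarrow> (real^3) set \<Rightarrow> bool" where
  "unit_speed_curve_on I x S \<longleftrightarrow>
     open I \<and> is_interval I \<and> x ` I \<subseteq> S \<and>
     x C1_differentiable_on I \<and> (\<lambda>s. vector_derivative x (at s)) C1_differentiable_on I \<and>
     (\<forall>s\<in>I. norm (vector_derivative x (at s)) = 1)"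

definition darboux_T :: "(real \<Rightarrow> real^3) \<Rightarrow> real \<Rightarrow> real^3" where
  "darboux_T x s = vector_derivative x (at s)"

definition darboux_n :: "(real^3 \<Rightarrow> real^3) \<Rightarrow> (real \<Rightarrow> real^3) \<Rightarrow> real \<Rightarrow> real^3" where
  "darboux_n N x s = N (x s)"

definition darboux_g :: "(real^3 \<Rightarrow> real^3) \<Rightarrow> (real \<Rightarrow> real^3) \<Rightarrow> real \<Rightarrow> real^3" where
  "darboux_g N x s = darboux_n N x s \<times> darboux_T x s"

text \<open>The three curvatures are the coefficients in the structure equations of the frame; that
  they satisfy all these equations is lemma \<open>darboux_equations\<close> below.\<close>

definition geodesic_curvature :: "(real^3 \<Rightarrow> real^3) \<Rightarrow> (real \<Rightarrow> real^3) \<Rightarrow> real \<Rightarrow> real" where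
  "geodesic_curvature N x s = vector_derivative (darboux_T x) (at s) \<bullet> darboux_g N x s"

definition normal_curvature :: "(real^3 \<Rightarrow> real^3) \<Rightarrow> (real \<Rightarrow> real^3) \<Rightarrow> real \<Rightarrow> real" where
  "normal_curvature N x s = vector_derivative (darboux_T x) (at s) \<bullet> darboux_n N x s"

definition geodesic_torsion :: "(real^3 \<Rightarrow> real^3) \<Rightarrow> (real \<Rightarrow> real^3) \<Rightarrow> real \<Rightarrow> real" where
  "geodesic_torsion N x s = vector_derivative (darboux_g N x) (at s) \<bullet> darboux_n N x s"

lemma darboux_orthonormal:
  assumes S: "oriented_surface S N" and x: "unit_speed_curve_on I x S" and s: "s \<in> I"
  shows "norm (darboux_T x s) = 1" "norm (darboux_n N x s) = 1" "norm (darboux_g N x s) = 1"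
    and "darboux_n N x s \<bullet> darboux_T x s = 0" "darboux_g N x s \<bullet> darboux_T x s = 0"
    and "darboux_g N x s \<bullet> darboux_n N x s = 0"
proof -
  have xS: "x s \<in> S" using x s by (auto simp: unit_speed_curve_on_def)
  show T1: "norm (darboux_T x s) = 1"
    using x s by (auto simp: unit_speed_curve_on_def darboux_T_def)
  show n1: "norm (darboux_n N x s) = 1"
    using S xS by (auto simp: oriented_surface_def darboux_n_def)
  obtain e where e: "e > 0" "ball s e \<subseteq> I"
    using x s by (auto simp: unit_speed_curve_on_def open_contains_ball)
  obtain D where D: "\<And>t. t \<in> I \<Longrightarrow> (x has_vector_derivative D t) (at t)" "continuous_on I D"
    using x by (auto simp: unit_speed_curve_on_def C1_differentiable_on_def)
  have sub: "s + t \<in> I" if "t \<in> {-e<..<e}" for t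
    using e that by (auto simp: dist_real_def subset_eq)
  have shift: "((\<lambda>t. x (s + t)) has_vector_derivative D (s + t)) (at t)"
    if "t \<in> {-e<..<e}" for t
  proof -
    have "((\<lambda>t. s + t) has_vector_derivative 1) (at t)"
      by (auto intro!: derivative_eq_intros)
    then have "((x \<circ> (\<lambda>t. s + t)) has_vector_derivative 1 *\<^sub>R D (s + t)) (at t)"
      by (rule vector_diff_chain_at) (rule D(1)[OF sub[OF that]])
    then show ?thesis by (simp add: o_def)
  qed
  have "(\<lambda>t. x (s + t)) C1_differentiable_on {-e<..<e}"
    unfolding C1_differentiable_on_def
    by (intro exI[of _ "\<lambda>t. D (s + t)"] conjI ballI shift continuous_on_compose2[OF D(2)])
      (auto intro!: continuous_intros sub)
  moreover have "(\<lambda>t. x (s + t)) ` {-e<..<e} \<subseteq> S"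
    using sub x by (auto simp: unit_speed_curve_on_def)
  moreover have "D s = darboux_T x s"
    using D(1)[OF s] by (simp add: darboux_T_def vector_derivative_at)
  ultimately have "darboux_T x s \<in> tangent_space S (x s)"
    unfolding tangent_space_def using shift[of 0] e(1)
    by (auto intro!: exI[of _ e] exI[of _ "\<lambda>t. x (s + t)"])
  then show nT: "darboux_n N x s \<bullet> darboux_T x s = 0"
    using S xS by (auto simp: oriented_surface_def darboux_n_def orthogonal_def)
  show "darboux_g N x s \<bullet> darboux_T x s = 0" "darboux_g N x s \<bullet> darboux_n N x s = 0"
    by (simp_all add: darboux_g_def dot_cross_self)
  have "(norm (darboux_g N x s))\<^sup>2 = 1"
    using norm_cross_dot[of "darboux_n N x s" "darboux_T x s"] T1 n1 nT
    by (simp add: darboux_g_def)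
  then show "norm (darboux_g N x s) = 1"
    using norm_ge_zero power2_eq_1_iff by (smt (verit))
qed

lemma orthonormal_expansion:
  fixes T n v :: "real^3"
  assumes "norm T = 1" "norm n = 1" "n \<bullet> T = 0"
  shows "v = (v \<bullet> T) *\<^sub>R T + (v \<bullet> (n \<times> T)) *\<^sub>R (n \<times> T) + (v \<bullet> n) *\<^sub>R n"
proof -
  define g where "g = n \<times> T"
  define w where "w = v - ((v \<bullet> T) *\<^sub>R T + (v \<bullet> g) *\<^sub>R g + (v \<bullet> n) *\<^sub>R n)"
  have sq: "T \<bullet> T = 1" "n \<bullet> n = 1" "T \<bullet> n = 0"
    using assms by (simp_all add: norm_eq_1 inner_commute)
  have g: "g \<bullet> T = 0" "g \<bullet> n = 0" "T \<bullet> g = 0" "n \<bullet> g = 0"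
    by (simp_all add: g_def dot_cross_self)
  have "(norm g)\<^sup>2 = 1"
    using norm_cross_dot[of n T] assms by (simp add: g_def)
  then have gg: "g \<bullet> g = 1" by (simp add: power2_norm_eq_inner)
  have w: "w \<bullet> T = 0" "w \<bullet> n = 0" "w \<bullet> g = 0"
    using sq g gg assms(3) by (simp_all add: w_def inner_diff_left inner_add_left)
  have "w \<times> g = (w \<bullet> T) *\<^sub>R n - (w \<bullet> n) *\<^sub>R T"
    unfolding g_def by (auto simp: cross3_simps forall_3)
  then have "w \<times> g = 0" using w by simp
  then have "(norm w * norm g)\<^sup>2 = 0"
    using norm_cross_dot[of w g] w by simp
  then have "w = 0" using gg by auto
  then show ?thesis by (simp add: w_def g_def)
qed

lemma darboux_equations:
  assumes S: "oriented_surface S N" and x: "unit_speed_curve_on I x S" and s: "s \<in> I"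
  shows "(darboux_T x has_vector_derivative
            geodesic_curvature N x s *\<^sub>R darboux_g N x s
            + normal_curvature N x s *\<^sub>R darboux_n N x s) (at s)"
    and "(darboux_g N x has_vector_derivative
            - geodesic_curvature N x s *\<^sub>R darboux_T x s
            + geodesic_torsion N x s *\<^sub>R darboux_n N x s) (at s)"
    and "(darboux_n N x has_vector_derivative
            - normal_curvature N x s *\<^sub>R darboux_T x s
            - geodesic_torsion N x s *\<^sub>R darboux_g N x s) (at s)"
proof -
  let ?T = "darboux_T x" and ?g = "darboux_g N x" and ?n = "darboux_n N x"
  have I: "open I" and xS: "\<And>t. t \<in> I \<Longrightarrow> x t \<in> S"
    using x by (auto simp: unit_speed_curve_on_def)
  have xT: "(x has_vector_derivative ?T s) (at s)"
    using x s vector_derivative_at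
    by (fastforce simp: unit_speed_curve_on_def C1_differentiable_on_def darboux_T_def)
  obtain T' where T': "(?T has_vector_derivative T') (at s)"
    using x s unfolding unit_speed_curve_on_def C1_differentiable_on_def darboux_T_def[abs_def]
    by blast
  obtain V G where V: "open V" "x s \<in> V" "Ck_on 1 G V" "\<forall>q\<in>S \<inter> V. G q = N q"
    using S xS[OF s] unfolding oriented_surface_def by blast
  obtain G' where "(G has_derivative G') (at (x s))"
    using V by (auto simp: differentiable_def)
  then have Gx: "((G \<circ> x) has_vector_derivative G' (?T s)) (at s)"
    using vector_derivative_diff_chain_within[of x "?T s" s UNIV G G'] xT
    by (simp add: has_derivative_at_withinI)
  have cx: "continuous_on I x"
    using x by (auto simp: unit_speed_curve_on_def C1_differentiable_imp_continuous_on)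
  have op: "open (I \<inter> x -` V)"
    by (rule continuous_open_preimage[OF cx I V(1)])
  have "(?n has_vector_derivative G' (?T s)) (at s)"
    by (rule has_vector_derivative_transform_within_open[OF Gx op])
      (use V s xS in \<open>auto simp: darboux_n_def\<close>)
  then obtain n' where n': "(?n has_vector_derivative n') (at s)" by blast
  have bl: "bounded_bilinear cross3"
    using bilinear_cross by (simp add: bilinear_conv_bounded_bilinear)
  obtain g' where g': "(?g has_vector_derivative g') (at s)"
    using bounded_bilinear.has_vector_derivative[OF bl n' T']
    by (auto simp: darboux_g_def[abs_def])
  note on = darboux_orthonormal[OF S x]
  have prod: "a s \<bullet> b' + a' \<bullet> b s = 0"
    if "(a has_vector_derivative a') (at s)" "(b has_vector_derivative b') (at s)"
      and c: "\<And>t. t \<in> I \<Longrightarrow> a t \<bullet> b t = c" for a b :: "real \<Rightarrow> real^3" and a' b' c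
  proof -
    have "((\<lambda>t. a t \<bullet> b t) has_vector_derivative a s \<bullet> b' + a' \<bullet> b s) (at s)"
      by (rule bounded_bilinear.has_vector_derivative[OF bounded_bilinear_inner that(1,2)])
    moreover have "((\<lambda>t. a t \<bullet> b t) has_vector_derivative 0) (at s)"
      by (rule has_vector_derivative_transform_within_open[OF has_vector_derivative_const I s])
        (simp add: c)
    ultimately show ?thesis by (metis vector_derivative_at)
  qed
  have TT: "T' \<bullet> ?T s = 0" and nn: "n' \<bullet> ?n s = 0" and gg: "g' \<bullet> ?g s = 0"
    using prod[OF T' T', of 1] prod[OF n' n', of 1] prod[OF g' g', of 1] on
    by (simp_all add: norm_eq_1 inner_commute)
  have nT: "n' \<bullet> ?T s = - (T' \<bullet> ?n s)" and gT: "g' \<bullet> ?T s = - (T' \<bullet> ?g s)"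
    and gn: "n' \<bullet> ?g s = - (g' \<bullet> ?n s)"
    using prod[OF n' T', of 0] prod[OF g' T', of 0] prod[OF g' n', of 0] on
    by (simp_all add: inner_commute)
  note ex = orthonormal_expansion[OF on(1,2,4)[OF s], folded darboux_g_def]
  have cs: "geodesic_curvature N x s = T' \<bullet> ?g s" "normal_curvature N x s = T' \<bullet> ?n s"
    "geodesic_torsion N x s = g' \<bullet> ?n s"
    using T' g' by (simp_all add: geodesic_curvature_def normal_curvature_def
        geodesic_torsion_def vector_derivative_at)
  show "(?T has_vector_derivative geodesic_curvature N x s *\<^sub>R ?g s
      + normal_curvature N x s *\<^sub>R ?n s) (at s)"
    using T' ex[of T'] by (simp add: cs TT)
  show "(?g has_vector_derivative - geodesic_curvature N x s *\<^sub>R ?T s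
      + geodesic_torsion N x s *\<^sub>R ?n s) (at s)"
    using g' ex[of g'] by (simp add: cs gg gT)
  show "(?n has_vector_derivative - normal_curvature N x s *\<^sub>R ?T s
      - geodesic_torsion N x s *\<^sub>R ?g s) (at s)"
    using n' ex[of n'] by (simp add: cs nn nT gn)
qed

section \<open>Mannheim partner D-curves\<close>

text \<open>\<open>\<sigma>\<close> is the correspondence, giving the parameter \<open>s = \<sigma> s1\<close> of the point of \<open>x\<close> that
  corresponds to \<open>x1 s1\<close>; \<open>x\<close> is the Mannheim D-curve and \<open>x1\<close> its partner.\<close>

definition mannheim_D_pair ::
  "(real^3) set \<Rightarrow> (real^3 \<Rightarrow> real^3) \<Rightarrow> real set \<Rightarrow> (real \<Rightarrow> real^3) \<Rightarrow>
   (real^3) set \<Rightarrow> (real^3 \<Rightarrow> real^3) \<Rightarrow> real set \<Rightarrow> (real \<Rightarrow> real^3) \<Rightarrow> (real \<Rightarrow> real) \<Rightarrow> bool" where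
  "mannheim_D_pair S N I x S1 N1 I1 x1 \<sigma> \<longleftrightarrow>
     oriented_surface S N \<and> unit_speed_curve_on I x S \<and>
     oriented_surface S1 N1 \<and> unit_speed_curve_on I1 x1 S1 \<and>
     \<sigma> differentiable_on I1 \<and> \<sigma> ` I1 = I \<and>
     (\<forall>s1\<in>I1. darboux_g N x (\<sigma> s1) = darboux_n N1 x1 s1) \<and>
     (\<exists>l. l \<noteq> 0 \<and> (\<forall>s1\<in>I1. x (\<sigma> s1) = x1 s1 + l *\<^sub>R darboux_n N1 x1 s1))"

end

theory Submission
  imports Defs
begin

text \<open>Corresponding points of a Mannheim D-pair share the unit vector \<open>g = n1\<close>, so the two remaining
  vectors of each Darboux frame span the same plane, the one orthogonal to it. The hypothesis on
  \<open>\<theta>\<close> places \<open>T\<close> in this plane, and orientation then places \<open>n\<close>: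

  \<open>T = cos \<theta> T1 + sin \<theta> g1\<close> and \<open>n = sin \<theta> T1 - cos \<theta> g1\<close>.

  Two identities between vector fields along \<open>x1\<close> are differentiated with respect to \<open>s1\<close>, using
  the chain rule and the structure equations of both frames. Differentiating the formula for \<open>T\<close>
  describes how \<open>T\<close> turns inside the plane, and the component along \<open>n\<close> is (i). Differentiating
  \<open>g = n1\<close> describes how the plane itself tilts, and the components along \<open>n\<close> and \<open>T\<close> are (ii)
  and (iii). Those two are a linear system for the normal curvature and the torsion of \<open>x1\<close> with
  orthogonal matrix; solving it for the torsion gives (iv).\<close>

lemma has_vector_derivative_unique_on_open:
  assumes "open U" "t \<in> U" "\<And>u. u \<in> U \<Longrightarrow> f u = h u"
    and "(f has_vector_derivative a) (at t)" "(h has_vector_derivative b) (at t)"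
  shows "a = b"
  using has_vector_derivative_transform_within_open[OF assms(4,1,2,3)] assms(5)
  by (rule vector_derivative_unique_at)

text \<open>Since \<open>(T, n \<times> T, n)\<close> is positively oriented, \<open>n = T \<times> (n \<times> T)\<close>. With \<open>n \<times> T = n1\<close> this is
  \<open>- n1 \<times> T\<close>, and \<open>v \<mapsto> n1 \<times> v\<close> is the quarter turn of the plane orthogonal to \<open>n1\<close>. The Darboux
  normal of the first curve is therefore \<open>T\<close> turned back by a right angle.\<close>

lemma normal_in_rotated_frame:
  fixes T n T1 n1 :: "real^3"
  assumes T: "norm T = 1" "n \<bullet> T = 0" and n1: "norm n1 = 1" "n1 \<bullet> T1 = 0"
    and g: "n \<times> T = n1" and rot: "T = c *\<^sub>R T1 + d *\<^sub>R (n1 \<times> T1)"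
  shows "n = d *\<^sub>R T1 - c *\<^sub>R (n1 \<times> T1)"
proof -
  have "n = T \<times> (n \<times> T)"
    using T by (simp add: Lagrange norm_eq_1 inner_commute)
  also have "\<dots> = - (n1 \<times> T)"
    using g by (metis cross_skew)
  also have "\<dots> = - (c *\<^sub>R (n1 \<times> T1) + d *\<^sub>R (n1 \<times> (n1 \<times> T1)))"
    by (subst rot) (simp add: cross_add_right cross_mult_right)
  also have "n1 \<times> (n1 \<times> T1) = - T1"
    using n1 by (simp add: Lagrange norm_eq_1)
  finally show ?thesis by simp
qed

theorem theorem3:
  fixes S S1 :: "(real^3) set" and N N1 :: "real^3 \<Rightarrow> real^3"
    and I I1 :: "real set" and x x1 :: "real \<Rightarrow> real^3" and \<sigma> \<theta> :: "real \<Rightarrow> real"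
  assumes "mannheim_D_pair S N I x S1 N1 I1 x1 \<sigma>"
    and "\<theta> differentiable_on I1"
    and "\<forall>s1\<in>I1. darboux_T x (\<sigma> s1) =
           cos (\<theta> s1) *\<^sub>R darboux_T x1 s1 + sin (\<theta> s1) *\<^sub>R darboux_g N1 x1 s1"
  shows "\<forall>s1\<in>I1.
      geodesic_curvature N1 x1 s1 = - (normal_curvature N x (\<sigma> s1) * deriv \<sigma> s1 + deriv \<theta> s1) \<and>
      geodesic_torsion N x (\<sigma> s1) * deriv \<sigma> s1 =
        - normal_curvature N1 x1 s1 * sin (\<theta> s1) + geodesic_torsion N1 x1 s1 * cos (\<theta> s1) \<and>
      geodesic_curvature N x (\<sigma> s1) * deriv \<sigma> s1 =
        normal_curvature N1 x1 s1 * cos (\<theta> s1) + geodesic_torsion N1 x1 s1 * sin (\<theta> s1) \<and>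
      geodesic_torsion N1 x1 s1 =
        (geodesic_curvature N x (\<sigma> s1) * sin (\<theta> s1)
          + geodesic_torsion N x (\<sigma> s1) * cos (\<theta> s1)) * deriv \<sigma> s1"
proof (intro ballI)
  fix t assume t: "t \<in> I1"
  have S: "oriented_surface S N" and x: "unit_speed_curve_on I x S"
    and S1: "oriented_surface S1 N1" and x1: "unit_speed_curve_on I1 x1 S1"
    and g: "\<And>u. u \<in> I1 \<Longrightarrow> darboux_g N x (\<sigma> u) = darboux_n N1 x1 u" and st: "\<sigma> t \<in> I"
    using assms(1) t by (auto simp: mannheim_D_pair_def)
  have op: "open I1" using x1 by (simp add: unit_speed_curve_on_def)
  have dif: "(f has_vector_derivative deriv f t) (at t)" if "f differentiable_on I1" for f
    using that op t by (metis at_within_open differentiable_on_def real_differentiable_def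
        DERIV_imp_deriv has_real_derivative_iff_has_vector_derivative)
  have \<sigma>: "(\<sigma> has_vector_derivative deriv \<sigma> t) (at t)"
    using assms(1) by (intro dif) (simp add: mannheim_D_pair_def)
  have \<theta>: "(\<theta> has_real_derivative deriv \<theta> t) (at t)"
    using dif[OF assms(2)] by (simp add: has_real_derivative_iff_has_vector_derivative)

  define T g n where "T = darboux_T x (\<sigma> t)" and "g = darboux_g N x (\<sigma> t)"
    and "n = darboux_n N x (\<sigma> t)"
  define T1 g1 n1 where "T1 = darboux_T x1 t" and "g1 = darboux_g N1 x1 t"
    and "n1 = darboux_n N1 x1 t"
  define kg kn \<tau> where "kg = geodesic_curvature N x (\<sigma> t)" and "kn = normal_curvature N x (\<sigma> t)"
    and "\<tau> = geodesic_torsion N x (\<sigma> t)"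
  define kg1 kn1 \<tau>1 where "kg1 = geodesic_curvature N1 x1 t" and "kn1 = normal_curvature N1 x1 t"
    and "\<tau>1 = geodesic_torsion N1 x1 t"
  define r c d where "r = deriv \<sigma> t" and "c = cos (\<theta> t)" and "d = sin (\<theta> t)"
  note defs = T_def g_def n_def T1_def g1_def n1_def kg_def kn_def \<tau>_def kg1_def kn1_def \<tau>1_def
    r_def c_def d_def

  note on = darboux_orthonormal[OF S x st, folded defs]
  note on1 = darboux_orthonormal[OF S1 x1 t, folded defs]
  have unit: "T \<bullet> T = 1" "n \<bullet> n = 1" "T1 \<bullet> T1 = 1" "g1 \<bullet> g1 = 1"
    using on on1 by (simp_all add: norm_eq_1)
  have orth: "n \<bullet> T = 0" "T \<bullet> n = 0" "g \<bullet> T = 0" "g \<bullet> n = 0" "g1 \<bullet> T1 = 0" "T1 \<bullet> g1 = 0"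
    using on on1 by (simp_all add: inner_commute)
  have cd: "c * c + d * d = 1"
    using sin_cos_squared_add2[of "\<theta> t"] by (simp add: c_def d_def power2_eq_square)
  have gn1: "g = n1" using g[OF t] by (simp add: g_def n1_def)
  have T: "T = c *\<^sub>R T1 + d *\<^sub>R g1"
    using assms(3) t by (simp add: defs)
  have "n \<times> T = n1" "g1 = n1 \<times> T1"
    using gn1 by (simp_all add: defs darboux_g_def)
  then have n: "n = d *\<^sub>R T1 - c *\<^sub>R g1"
    using normal_in_rotated_frame[of T n n1 T1 c d] on(1,4) on1(2,4) T by simp

  note eqs = darboux_equations[OF S x st, folded defs]
  note eqs1 = darboux_equations[OF S1 x1 t, folded defs]
  note \<sigma>' = \<sigma>[folded r_def]
  have dT: "((\<lambda>u. darboux_T x (\<sigma> u)) has_vector_derivative r *\<^sub>R (kg *\<^sub>R g + kn *\<^sub>R n)) (at t)"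
    using vector_diff_chain_at[OF \<sigma>' eqs(1)] by (simp add: o_def)
  have dg: "((\<lambda>u. darboux_g N x (\<sigma> u)) has_vector_derivative r *\<^sub>R (- kg *\<^sub>R T + \<tau> *\<^sub>R n)) (at t)"
    using vector_diff_chain_at[OF \<sigma>' eqs(2)] by (simp add: o_def)
  have dcos: "((\<lambda>u. cos (\<theta> u)) has_real_derivative - d * deriv \<theta> t) (at t)"
    and dsin: "((\<lambda>u. sin (\<theta> u)) has_real_derivative c * deriv \<theta> t) (at t)"
    unfolding c_def d_def by (auto intro!: derivative_eq_intros \<theta>)
  have dT1: "((\<lambda>u. cos (\<theta> u) *\<^sub>R darboux_T x1 u + sin (\<theta> u) *\<^sub>R darboux_g N1 x1 u)
      has_vector_derivative
        (c *\<^sub>R (kg1 *\<^sub>R g1 + kn1 *\<^sub>R n1) + (- d * deriv \<theta> t) *\<^sub>R T1)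
        + (d *\<^sub>R (- kg1 *\<^sub>R T1 + \<tau>1 *\<^sub>R n1) + (c * deriv \<theta> t) *\<^sub>R g1)) (at t)"
    using has_vector_derivative_add[OF has_vector_derivative_scaleR[OF dcos eqs1(1)]
        has_vector_derivative_scaleR[OF dsin eqs1(2)]]
    by (simp only: T1_def g1_def c_def d_def)

  (* The derivatives of the two sides of each frame identity, both of which hold along the whole
     open interval, agree at t. *)
  have rotation_T: "r *\<^sub>R (kg *\<^sub>R g + kn *\<^sub>R n) =
        (c *\<^sub>R (kg1 *\<^sub>R g1 + kn1 *\<^sub>R n1) + (- d * deriv \<theta> t) *\<^sub>R T1)
        + (d *\<^sub>R (- kg1 *\<^sub>R T1 + \<tau>1 *\<^sub>R n1) + (c * deriv \<theta> t) *\<^sub>R g1)"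
    by (rule has_vector_derivative_unique_on_open[OF op t _ dT dT1]) (use assms(3) in auto)
  have rotation_g: "r *\<^sub>R (- kg *\<^sub>R T + \<tau> *\<^sub>R n) = - kn1 *\<^sub>R T1 - \<tau>1 *\<^sub>R g1"
    by (rule has_vector_derivative_unique_on_open[OF op t _ dg eqs1(3)]) (rule g)

  have T1n: "T1 \<bullet> n = d" and g1n: "g1 \<bullet> n = - c" and T1T: "T1 \<bullet> T = c" and g1T: "g1 \<bullet> T = d"
    and n1n: "n1 \<bullet> n = 0"
    using unit(3,4) orth(4-6) gn1 unfolding n T
    by (simp_all add: inner_diff_right inner_add_right)
  have "r * kn = - (c * c + d * d) * (kg1 + deriv \<theta> t)"
    using arg_cong[OF rotation_T, of "\<lambda>v. v \<bullet> n"]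
    by (simp add: inner_add_left inner_diff_left T1n g1n n1n unit orth algebra_simps)
  then have i: "kg1 = - (kn * r + deriv \<theta> t)"
    by (simp add: cd algebra_simps)
  have ii: "\<tau> * r = - kn1 * d + \<tau>1 * c"
    using arg_cong[OF rotation_g, of "\<lambda>v. v \<bullet> n"]
    by (simp add: inner_add_left inner_diff_left T1n g1n unit orth algebra_simps)
  have iii: "kg * r = kn1 * c + \<tau>1 * d"
    using arg_cong[OF rotation_g, of "\<lambda>v. v \<bullet> T"]
    by (simp add: inner_add_left inner_diff_left T1T g1T unit orth algebra_simps)
  have "(kg * d + \<tau> * c) * r = (kg * r) * d + (\<tau> * r) * c"
    by (simp add: algebra_simps)
  also have "\<dots> = \<tau>1 * (c * c + d * d)"
    unfolding ii iii by (simp add: algebra_simps)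
  finally have iv: "\<tau>1 = (kg * d + \<tau> * c) * r"
    by (simp add: cd)
  show "geodesic_curvature N1 x1 t = - (normal_curvature N x (\<sigma> t) * deriv \<sigma> t + deriv \<theta> t) \<and>
      geodesic_torsion N x (\<sigma> t) * deriv \<sigma> t =
        - normal_curvature N1 x1 t * sin (\<theta> t) + geodesic_torsion N1 x1 t * cos (\<theta> t) \<and>
      geodesic_curvature N x (\<sigma> t) * deriv \<sigma> t =
        normal_curvature N1 x1 t * cos (\<theta> t) + geodesic_torsion N1 x1 t * sin (\<theta> t) \<and>
      geodesic_torsion N1 x1 t =
        (geodesic_curvature N x (\<sigma> t) * sin (\<theta> t)
          + geodesic_torsion N x (\<sigma> t) * cos (\<theta> t)) * deriv \<sigma> t"
    using i ii iii iv unfolding defs by blast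
qed

end
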